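(* Let $\omega>0$ and $\sigma_0>0$. The power series expansion around $T=0$ of the scaling-limit implied variance $T\mapsto\hat\Sigma_{\rm BS}^2\left(\tfrac12\omega\sigma_0T\right)$ has the finite radius of convergence $$T_c=\frac{2R_\tau}{\omega\sigma_0}\simeq\frac{1.32}{\omega\sigma_0},\qquad R_\tau=\frac{y_0}{\cosh y_0}\simeq0.662743,$$ where $y_0\simeq1.19968$ is the positive solution of $y\tanh y=1$.
   Context: The function $\hat\Sigma_{\rm BS}^2$ is defined near $\tau=0$ by $$\hat\Sigma_{\rm BS}^2(\tau)=\frac{\sin2\lambda}{\lambda}-\frac12(1+\cos(2\lambda)),\qquad\lambda=\lambda(\tau),$$ where $\lambda(\tau)$ is the analytic local inverse, with $\lambda(0)=0$, of the map $\lambda\mapsto\tau=\frac{\lambda}{\cos\lambda}$, and $\frac{\sin2\lambda}{\lambda}$ is understood as $2$ at $\lambda=0$. (Interpretation: $\hat\Sigma^2_{\rm BS}(\tfrac12\omega\sigma_0T)$ is the limit of $(\sigma_{\rm BS}/\sigma_0)^2$, with $\sigma_{\rm BS}$ the at-the-money implied volatility at maturity $T$ in the uncorrelated log-normal SABR model $dS_t=\sigma_tS_t\,dW_t$, $d\sigma_t=\omega\sigma_t\,dZ_t$, as $\omega\to0$, $\sigma_0\to\infty$ with the product $\omega\sigma_0$ held fixed.) *)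

theory Defs
  imports "HOL-Complex_Analysis.Complex_Analysis"
begin

text \<open>The map is taken on the complex plane, so that its analytic local inverse at the origin and
  the resulting power series are the usual complex ones. At the zeros of the cosine the value is the
  conventional 0; only values near 0 matter below.\<close>

definition tau_map :: "complex \<Rightarrow> complex" where
  "tau_map l = l / cos l"

definition analytic_local_inverse_at_0 ::
    "(complex \<Rightarrow> complex) \<Rightarrow> (complex \<Rightarrow> complex) \<Rightarrow> bool" where
  "analytic_local_inverse_at_0 f g \<longleftrightarrow>
     g analytic_on {0} \<and> g 0 = 0 \<and>
     (\<forall>\<^sub>F t in nhds 0. f (g t) = t) \<and> (\<forall>\<^sub>F l in nhds 0. g (f l) = l)"

text \<open>Scaling-limit implied variance, relative to a choice \<open>lam\<close> of the local inverse of
  \<^const>\<open>tau_map\<close>; its germ at 0 does not depend on that choice.\<close>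

definition Sigma_BS_sq :: "(complex \<Rightarrow> complex) \<Rightarrow> complex \<Rightarrow> complex" where
  "Sigma_BS_sq lam \<tau> =
     (if lam \<tau> = 0 then 2 else sin (2 * lam \<tau>) / lam \<tau>) - 1 / 2 * (1 + cos (2 * lam \<tau>))"

definition y0 :: real where
  "y0 = (THE y. 0 < y \<and> y * tanh y = 1)"

definition R_tau :: real where
  "R_tau = y0 / cosh y0"

end

theory Submission
  imports Defs
begin

text \<open>
  The branch. A preimage \<open>l\<close> of \<open>t\<close> under \<open>l / cos l\<close> is a fixed point of \<open>l \<mapsto> t * cos l\<close>. Since
  \<open>\<bar>cos l\<bar> \<le> cosh \<bar>l\<bar>\<close> and \<open>\<bar>sin l\<bar> \<le> sinh \<bar>l\<bar>\<close>, and since \<open>R_tau * cosh y0 = y0\<close> and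
  \<open>R_tau * sinh y0 = 1\<close>, for \<open>\<bar>t\<bar> < R_tau\<close> this map is a contraction of the closed disc of radius
  \<open>y0\<close> into itself. So the local inverse extends to the disc \<open>\<bar>t\<bar> < R_tau\<close>.

  The singularity. At \<open>l = \<i> y0\<close>, which maps to the boundary point \<open>\<i> R_tau\<close>, the derivatives of
  both \<open>l / cos l\<close> and the implied variance (as a function of \<open>l\<close>) vanish. Thus the first
  derivative with respect to \<open>t\<close> stays bounded there, and only the second one detects that the
  variance does not extend.

  The numerics. \<open>1 / cosh\<^sup>2 = 1 - tanh\<^sup>2\<close> gives \<open>R_tau\<^sup>2 = y0\<^sup>2 - 1\<close>, so bounds on \<open>y0\<close> suffice.
\<close>

subsection \<open>The critical point\<close>

text \<open>The equation \<open>y * tanh y = 1\<close> multiplied by \<open>cosh y\<close>: in this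
  form the derivative \<open>- (y * cosh y)\<close> makes monotonicity immediate.\<close>

definition crit :: "real \<Rightarrow> real" where
  "crit y = cosh y - y * sinh y"

lemma crit_deriv: "(crit has_real_derivative - (y * cosh y)) (at y within A)"
  unfolding crit_def by (auto intro!: derivative_eq_intros)

lemma crit_less: "crit y < crit x" if "0 \<le> x" "x < y"
proof (rule DERIV_neg_imp_decreasing_open[OF that(2)])
  show "\<exists>d. DERIV crit t :> d \<and> d < 0" if "x < t" "t < y" for t
    using crit_deriv[of t UNIV] that \<open>0 \<le> x\<close>
    by (intro exI[of _ "- (t * cosh t)"]) auto
  show "continuous_on {x..y} crit"
    using crit_deriv by (intro DERIV_continuous_on) blast
qed

lemma crit_less_iff: "crit x < crit y \<longleftrightarrow> y < x" if "0 \<le> x" "0 \<le> y"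
  using crit_less[of x y] crit_less[of y x] that by (cases x y rule: linorder_cases) auto

lemma mult_tanh_eq_1_iff: "y * tanh y = 1 \<longleftrightarrow> crit y = 0" for y :: real
  by (simp add: crit_def tanh_def field_simps)

text \<open>Scaling by \<open>2 * exp y\<close> leaves a single exponential, so for rational y > 1
  the sign of \<open>crit y\<close> is decided by comparing \<open>exp (2 * y)\<close> with the
  rational number (y + 1) / (y - 1).\<close>

lemma exp_crit: "exp (2 * y) * (y - 1) - (y + 1) = - (2 * exp y * crit y)"
  by (simp add: crit_def cosh_def sinh_def algebra_simps exp_double power2_eq_square
      flip: exp_add)

lemma crit_pos_iff: "0 < crit y \<longleftrightarrow> exp (2 * y) * (y - 1) < y + 1"
  using exp_crit[of y] by (smt (verit) exp_gt_zero zero_less_mult_iff)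

lemma crit_neg_iff: "crit y < 0 \<longleftrightarrow> y + 1 < exp (2 * y) * (y - 1)"
  using exp_crit[of y] by (smt (verit) exp_gt_zero mult_less_0_iff)

text \<open>Lagrange remainder; its factor \<open>exp t\<close> lies between 0 and 27, because t
  \<le> 3 and e \<le> 3.\<close>

lemma exp_Taylor_bounds:
  fixes x :: real
  assumes "0 \<le> x" "x \<le> 3"
  shows "(\<Sum>m<n. x ^ m / fact m) \<le> exp x"
    and "exp x \<le> (\<Sum>m<n. x ^ m / fact m) + 27 / fact n * x ^ n"
proof -
  obtain t where t: "\<bar>t\<bar> \<le> \<bar>x\<bar>" "exp x = (\<Sum>m<n. x ^ m / fact m) + (exp t / fact n) * x ^ n"
    using Maclaurin_exp_le by blast
  have "exp t \<le> exp (of_nat 3 * 1)"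
    using t assms by simp
  also have "\<dots> = exp 1 ^ 3"
    by (rule exp_of_nat_mult)
  also have "\<dots> \<le> (3::real) ^ 3"
    by (intro power_mono exp_le) simp
  finally have "exp t \<le> 27" by simp
  then have "exp t / fact n * x ^ n \<le> 27 / fact n * x ^ n"
    using assms by (intro mult_right_mono divide_right_mono) auto
  with t show "exp x \<le> (\<Sum>m<n. x ^ m / fact m) + 27 / fact n * x ^ n"
    by simp
  have "0 \<le> exp t / fact n * x ^ n" using assms by simp
  with t show "(\<Sum>m<n. x ^ m / fact m) \<le> exp x" by simp
qed

text \<open>The bracket 2986/2489 = 1.19967858..., 18667/15560 = 1.19967866... around the zero of
  \<open>crit\<close> consists of fractions with small denominators, to keep the Taylor sums cheap.\<close>

lemma crit_lower_pos: "0 < crit (2986 / 2489)"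
proof -
  have "exp (5972 / 2489 :: real)
      \<le> (\<Sum>m<16. (5972 / 2489) ^ m / fact m) + 27 / fact 16 * (5972 / 2489) ^ 16"
    by (rule exp_Taylor_bounds) auto
  \<comment> \<open>5475 / 497 is (y + 1) / (y - 1) at y = 2986 / 2489.\<close>
  also have "\<dots> < 5475 / 497"
    by (simp add: lessThan_nat_numeral fact_numeral power_divide)
  finally show ?thesis
    unfolding crit_pos_iff by (simp add: field_simps)
qed

lemma crit_upper_neg: "crit (18667 / 15560) < 0"
proof -
  \<comment> \<open>34227 / 3107 is (y + 1) / (y - 1) at y = 18667 / 15560.\<close>
  have "34227 / 3107 < (\<Sum>m<15. (18667 / 7780) ^ m / fact m :: real)"
    by (simp add: lessThan_nat_numeral fact_numeral power_divide)
  also have "\<dots> \<le> exp (18667 / 7780 :: real)"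
    by (rule exp_Taylor_bounds) auto
  finally show ?thesis
    unfolding crit_neg_iff by (simp add: field_simps)
qed

lemma ex1_crit: "\<exists>!y::real. 0 < y \<and> y * tanh y = 1"
proof -
  have "\<exists>y\<ge>(2986 / 2489). y \<le> (18667 / 15560) \<and> crit y = 0"
  proof (rule IVT2')
    show "continuous_on {2986 / 2489..18667 / 15560} crit"
      using crit_deriv by (intro DERIV_continuous_on) blast
  qed (use crit_lower_pos crit_upper_neg in auto)
  then obtain y where "2986 / 2489 \<le> y" and y: "crit y = 0" by blast
  then have "0 < y" by simp
  moreover have "z = y" if "0 < z" "crit z = 0" for z
    using crit_less[of y z] crit_less[of z y] \<open>0 < y\<close> y that by (cases z y rule: linorder_cases) auto
  ultimately show ?thesis
    unfolding mult_tanh_eq_1_iff using y by blast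
qed

lemma y0_pos: "0 < y0" and crit_y0: "crit y0 = 0"
  using theI'[OF ex1_crit] unfolding y0_def[symmetric] unfolding mult_tanh_eq_1_iff by auto

lemma y0_sinh: "y0 * sinh y0 = cosh y0"
  using crit_y0 by (simp add: crit_def)

lemma crit_pos: "0 < crit y" if "0 \<le> y" "y < y0"
  using crit_less[OF that] crit_y0 by simp

lemma y0_bounds: "2986 / 2489 < y0" "y0 < 18667 / 15560"
  using crit_less_iff[of y0 "2986 / 2489"] crit_less_iff[of "18667 / 15560" y0] y0_pos crit_y0
    crit_lower_pos crit_upper_neg by auto

lemma R_tau_pos: "0 < R_tau"
  using y0_pos by (simp add: R_tau_def)

lemma R_tau_cosh: "R_tau * cosh y0 = y0"
  by (simp add: R_tau_def)

lemma R_tau_sinh: "R_tau * sinh y0 = 1"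
proof -
  have "R_tau * sinh y0 * y0 = y0"
    using y0_sinh R_tau_cosh by (simp add: mult.assoc mult.commute[of "sinh y0"])
  then show ?thesis using y0_pos by simp
qed

lemma R_tau_sq: "R_tau\<^sup>2 = y0\<^sup>2 - 1"
proof -
  have "y0\<^sup>2 - 1 = R_tau\<^sup>2 * (cosh y0)\<^sup>2 - R_tau\<^sup>2 * (sinh y0)\<^sup>2"
    by (simp add: R_tau_cosh R_tau_sinh flip: power_mult_distrib)
  also have "\<dots> = R_tau\<^sup>2"
    by (simp add: cosh_square_eq algebra_simps)
  finally show ?thesis by simp
qed

lemma R_tau_bounds: "0.6627425 < R_tau" "R_tau < 0.6627435"
proof -
  have "(2986 / 2489)\<^sup>2 < y0\<^sup>2" "y0\<^sup>2 < (18667 / 15560)\<^sup>2"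
    using y0_bounds y0_pos by (auto intro: power_strict_mono)
  moreover have "0.6627425\<^sup>2 < (2986 / 2489)\<^sup>2 - (1::real)"
    "(18667 / 15560)\<^sup>2 - 1 < (0.6627435\<^sup>2 :: real)"
    by (simp_all add: power2_eq_square)
  ultimately have "0.6627425\<^sup>2 < R_tau\<^sup>2" "R_tau\<^sup>2 < 0.6627435\<^sup>2"
    unfolding R_tau_sq by linarith+
  then show "0.6627425 < R_tau" "R_tau < 0.6627435"
    using R_tau_pos by (intro power_less_imp_less_base[of _ 2 R_tau]
      power_less_imp_less_base[of R_tau 2]; simp)+
qed

text \<open>The derivative of y / cosh y is \<open>crit y / (cosh y)\<^sup>2\<close>, positive up to
  \<open>y0\<close>.\<close>

lemma quotient_cosh_less_R_tau: "y / cosh y < R_tau" if "0 \<le> y" "y < y0"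
  unfolding R_tau_def
proof (rule DERIV_pos_imp_increasing_open[OF that(2)])
  show "\<exists>d. ((\<lambda>y. y / cosh y) has_real_derivative d) (at t) \<and> 0 < d" if "y < t" "t < y0" for t
    using crit_pos[of t] that \<open>0 \<le> y\<close>
    by (intro exI[of _ "crit t / (cosh t)\<^sup>2"])
      (auto intro!: derivative_eq_intros simp: crit_def power2_eq_square)
qed (auto intro!: continuous_intros)

subsection \<open>The inverse branch on the disc of radius \<open>R_tau\<close>\<close>

text \<open>Termwise comparison: the coefficients of cosh are the absolute values of those of
  cos.\<close>

lemma norm_cos_le_cosh: "norm (cos z) \<le> cosh (norm z)" for z :: complex
  by (rule norm_sums_le[OF cos_converges cosh_converges])
    (auto simp: cos_coeff_def norm_power norm_mult norm_divide field_simps)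

lemma norm_sin_le_sinh: "norm (sin z) \<le> sinh (norm z)" for z :: complex
  by (rule norm_sums_le[OF sin_converges sinh_converges])
    (auto simp: sin_coeff_def norm_power norm_mult norm_divide field_simps)

lemma norm_mult_sin_less_1: "norm (t * sin z) < 1"
  if "norm t < R_tau" "norm z \<le> y0" for t z :: complex
proof -
  have "norm (t * sin z) \<le> norm t * sinh y0"
    unfolding norm_mult using norm_sin_le_sinh[of z] that(2)
    by (intro mult_left_mono) (auto intro: order_trans)
  also have "\<dots> < R_tau * sinh y0"
    using that y0_pos by (intro mult_strict_right_mono) auto
  finally show ?thesis by (simp add: R_tau_sinh)
qed

text \<open>Gives the self-map of the closed disc; strictness puts the fixed point into the open
  disc.\<close>

lemma norm_mult_cos_less_y0: "norm (t * cos z) < y0"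
  if "norm t < R_tau" "norm z \<le> y0" for t z :: complex
proof -
  have "cosh (norm z) \<le> cosh y0"
    using that(2) y0_pos by (subst cosh_real_nonneg_le_iff) auto
  then have "norm (t * cos z) \<le> norm t * cosh y0"
    unfolding norm_mult using norm_cos_le_cosh[of z]
    by (intro mult_left_mono) (auto intro: order_trans)
  also have "\<dots> < R_tau * cosh y0"
    using that by (intro mult_strict_right_mono) auto
  finally show ?thesis by (simp add: R_tau_cosh)
qed

lemma ex1_fixed_point:
  fixes t :: complex
  assumes t: "norm t < R_tau"
  shows "\<exists>!l\<in>cball 0 y0. t * cos l = l"
proof (rule Banach_fix)
  show "complete (cball (0::complex) y0)" by (intro compact_imp_complete) simp
  show "cball (0::complex) y0 \<noteq> {}" using y0_pos by auto
  show "0 \<le> norm t * sinh y0" using y0_pos by simp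
  show "norm t * sinh y0 < 1"
    using mult_strict_right_mono[OF t, of "sinh y0"] y0_pos by (simp add: R_tau_sinh)
  show "(\<lambda>l. t * cos l) ` cball 0 y0 \<subseteq> cball 0 y0"
    using norm_mult_cos_less_y0[OF t] by (force intro: less_imp_le)
  show "dist (t * cos x) (t * cos y) \<le> norm t * sinh y0 * dist x y"
    if "x \<in> cball 0 y0" "y \<in> cball 0 y0" for x y
    unfolding dist_norm
  proof (rule field_differentiable_bound[OF convex_cball _ _ that])
    show "((\<lambda>l. t * cos l) has_field_derivative - (t * sin z)) (at z within cball 0 y0)" for z
      by (auto intro!: derivative_eq_intros)
    show "norm (- (t * sin z)) \<le> norm t * sinh y0" if "z \<in> cball 0 y0" for z
      unfolding norm_minus_cancel norm_mult using norm_sin_le_sinh[of z] that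
      by (intro mult_left_mono) (auto intro: order_trans)
  qed
qed

text \<open>The range of the inverse branch over the disc of radius \<open>R_tau\<close>. Demanding
  \<open>cos l \<noteq> 0\<close> keeps the conventional value of \<open>tau_map\<close> at zeros of
  the cosine out without locating them.\<close>

definition branch_dom :: "complex set" where
  "branch_dom = {l. norm l < y0 \<and> cos l \<noteq> 0 \<and> norm (tau_map l) < R_tau}"

lemma tau_map_deriv:
  "(tau_map has_field_derivative (cos l + l * sin l) / (cos l)\<^sup>2) (at l within A)" if "cos l \<noteq> 0"
  unfolding tau_map_def using that
  by (auto intro!: derivative_eq_intros simp: power2_eq_square)

lemma open_branch_dom: "open branch_dom"
proof -
  have "open {l::complex. cos l \<noteq> 0}"
    by (intro open_Collect_neq continuous_intros)
  have "continuous_on {l. cos l \<noteq> 0} tau_map"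
    unfolding tau_map_def by (intro continuous_intros) auto
  then have "open ({l. cos l \<noteq> 0} \<inter> tau_map -` ball 0 R_tau)"
    by (intro continuous_open_preimage \<open>open {l. cos l \<noteq> 0}\<close> open_ball)
  then have "open (ball 0 y0 \<inter> ({l. cos l \<noteq> 0} \<inter> tau_map -` ball 0 R_tau))"
    by (rule open_Int[OF open_ball])
  also have "ball 0 y0 \<inter> ({l. cos l \<noteq> 0} \<inter> tau_map -` ball 0 R_tau) = branch_dom"
    by (auto simp: branch_dom_def)
  finally show ?thesis .
qed

lemma zero_in_branch_dom: "0 \<in> branch_dom"
  using y0_pos R_tau_pos by (simp add: branch_dom_def tau_map_def)

text \<open>Two preimages of t are fixed points of the same contraction.\<close>

lemma inj_on_tau_map: "inj_on tau_map branch_dom"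
proof (rule inj_onI)
  fix a b assume *: "a \<in> branch_dom" "b \<in> branch_dom" "tau_map a = tau_map b"
  have fixed: "tau_map l * cos l = l" if "l \<in> branch_dom" for l
    using that by (simp add: branch_dom_def tau_map_def)
  have "norm (tau_map a) < R_tau" "a \<in> cball 0 y0" "b \<in> cball 0 y0"
    using * by (auto simp: branch_dom_def)
  then show "a = b"
    using ex1_fixed_point[of "tau_map a"] fixed[OF *(1)] fixed[OF *(2)] *(3) by auto
qed

lemma tau_map_image: "tau_map ` branch_dom = ball 0 R_tau"
proof
  show "ball 0 R_tau \<subseteq> tau_map ` branch_dom"
  proof
    fix t :: complex assume "t \<in> ball 0 R_tau"
    then have t: "norm t < R_tau" by simp
    obtain l where "l \<in> cball 0 y0" and l: "t * cos l = l"
      using ex1_fixed_point[OF t] by blast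
    then have l_le: "norm l \<le> y0" by simp
    \<comment> \<open>If \<open>cos l = 0\<close>, the fixed-point equation forces
      \<open>l = 0\<close>, where the cosine is 1.\<close>
    have "cos l \<noteq> 0"
      using l by (cases "l = 0") auto
    then have eq: "tau_map l = t"
      using l by (simp add: tau_map_def divide_eq_eq)
    moreover have "norm l < y0"
      using norm_mult_cos_less_y0[OF t l_le] l by simp
    ultimately have "l \<in> branch_dom"
      using t \<open>cos l \<noteq> 0\<close> by (simp add: branch_dom_def)
    with eq show "t \<in> tau_map ` branch_dom" by blast
  qed
qed (auto simp: branch_dom_def)

lemma ex_branch:
  obtains G where "G holomorphic_on ball 0 R_tau" "\<And>l. l \<in> branch_dom \<Longrightarrow> G (tau_map l) = l"
    "\<And>t. norm t < R_tau \<Longrightarrow> G t \<in> branch_dom \<and> tau_map (G t) = t"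
proof -
  have "tau_map holomorphic_on branch_dom"
    unfolding tau_map_def by (intro holomorphic_intros) (auto simp: branch_dom_def)
  then obtain G where G: "G holomorphic_on tau_map ` branch_dom" "\<And>l. l \<in> branch_dom \<Longrightarrow> G (tau_map l) = l"
    using holomorphic_has_inverse[OF _ open_branch_dom inj_on_tau_map] by metis
  moreover have "G t \<in> branch_dom \<and> tau_map (G t) = t" if "norm t < R_tau" for t
  proof -
    have "t \<in> tau_map ` branch_dom" using that tau_map_image by simp
    then show ?thesis using G(2) by auto
  qed
  ultimately show ?thesis using that tau_map_image by simp
qed

subsection \<open>The singularity on the circle of convergence\<close>

text \<open>The implied variance in the variable l, where it is entire; a singularity in t can only
  come from the inverse branch.\<close>

definition profile :: "complex \<Rightarrow> complex" where
  "profile l = (if l = 0 then 2 else sin (2 * l) / l) - 1 / 2 * (1 + cos (2 * l))"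

lemma Sigma_BS_sq_eq_profile: "Sigma_BS_sq lam \<tau> = profile (lam \<tau>)"
  by (simp add: Sigma_BS_sq_def profile_def)

lemma profile_holomorphic: "profile holomorphic_on A"
proof -
  have "((\<lambda>l. sin (2 * l)) has_field_derivative 2) (at (0::complex))"
    by (auto intro!: derivative_eq_intros)
  then have "(\<lambda>l. sin (2 * l) / l) \<midarrow>0\<rightarrow> (2::complex)"
    by (simp add: has_field_derivative_iff)
  then have "(\<lambda>l::complex. if l = 0 then 2 else sin (2 * l) / l) holomorphic_on UNIV"
    by (intro removable_singularity holomorphic_intros) auto
  then have "profile holomorphic_on UNIV"
    unfolding profile_def by (intro holomorphic_intros)
  then show ?thesis by (rule holomorphic_on_subset) simp
qed

text \<open>The factored form exhibits \<open>cos l + l * sin l\<close>, which is also the numerator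
  of the derivative of \<open>tau_map\<close>.\<close>

lemma profile_deriv:
  assumes "l \<noteq> 0"
  shows "(profile has_field_derivative
    2 / l\<^sup>2 * ((cos l + l * sin l) * (l * cos l - sin l))) (at l)"
proof -
  have "((\<lambda>l. sin (2 * l) / l - 1 / 2 * (1 + cos (2 * l))) has_field_derivative
      (2 * cos (2 * l) * l - sin (2 * l)) / l\<^sup>2 + sin (2 * l)) (at l)"
    using assms by (auto intro!: derivative_eq_intros simp: power2_eq_square)
  also have "(2 * cos (2 * l) * l - sin (2 * l)) / l\<^sup>2 + sin (2 * l)
      = 2 / l\<^sup>2 * ((cos l + l * sin l) * (l * cos l - sin l))"
    unfolding sin_double cos_double
    using assms by (simp add: field_simps power2_eq_square)
  finally show ?thesis
    by (rule has_field_derivative_transform_within_open[where S = "- {0}"])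
      (use assms in \<open>auto simp: profile_def\<close>)
qed

text \<open>The derivative of \<open>profile\<close> divided by that of \<open>tau_map\<close>, with
  the common factor cancelled, so that it makes sense at the critical point.\<close>

definition slope :: "complex \<Rightarrow> complex" where
  "slope l = 2 * (cos l)\<^sup>2 / l\<^sup>2 * (l * cos l - sin l)"

text \<open>Grouped so that the first summand contains \<open>cos l + l * sin l\<close>; at \<i>
  \<open>y0\<close> only the second one survives.\<close>

definition slope' :: "complex \<Rightarrow> complex" where
  "slope' l = - 2 * cos l * (2 * (cos l + l * sin l) * (l * cos l - sin l) / l ^ 3
     + cos l * sin l / l)"

lemma slope_deriv:
  assumes "l \<noteq> 0"
  shows "(slope has_field_derivative slope' l) (at l)"
  unfolding slope_def slope'_def using assms
  by (auto intro!: derivative_eq_intros simp: field_simps power2_eq_square power3_eq_cube)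

lemma cos_imaginary: "cos (\<i> * of_real y) = of_real (cosh y)"
  by (simp add: cosh_def cos_i_times exp_of_real exp_minus scaleR_conv_of_real flip: of_real_exp)

lemma sin_imaginary: "sin (\<i> * of_real y) = \<i> * of_real (sinh y)"
  by (simp add: sinh_def sin_i_times exp_of_real exp_minus scaleR_conv_of_real flip: of_real_exp)

lemma slope'_y0: "slope' (\<i> * of_real y0) \<noteq> 0"
proof -
  have "cosh y0 \<noteq> 0" "sinh y0 \<noteq> 0" "y0 \<noteq> 0"
    using y0_pos by auto
  moreover have "cos (\<i> * of_real y0) + \<i> * of_real y0 * sin (\<i> * of_real y0) = 0"
    by (simp add: cos_imaginary sin_imaginary algebra_simps flip: of_real_mult y0_sinh)
  ultimately show ?thesis
    unfolding slope'_def by (simp add: cos_imaginary sin_imaginary)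
qed

text \<open>A critical point l with t = \<open>tau_map l\<close> would satisfy
  \<open>t * sin l = -1\<close>, against the contraction bound.\<close>

lemma cos_plus_mult_sin_nonzero: "cos l + l * sin l \<noteq> 0" if "l \<in> branch_dom"
proof
  assume *: "cos l + l * sin l = 0"
  have "tau_map l * sin l = -1"
    using that * by (simp add: branch_dom_def tau_map_def field_simps add_eq_0_iff)
  moreover have "norm (tau_map l * sin l) < 1"
    using that by (intro norm_mult_sin_less_1) (auto simp: branch_dom_def)
  ultimately show False by simp
qed

lemma imaginary_in_branch_dom: "\<i> * of_real y \<in> branch_dom" if "0 \<le> y" "y < y0"
  using that quotient_cosh_less_R_tau[OF that]
  by (auto simp: branch_dom_def tau_map_def cos_imaginary norm_mult norm_divide)

text \<open>An extension \<open>H\<close> would satisfy \<open>H' (tau_map l) = slope l\<close> after cancelling the common factor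
  \<open>cos l + l * sin l\<close>, hence \<open>H'' (tau_map l) * tau_map' l = slope' l\<close>, where the left-hand side is
  0 at \<open>l = \<i> y0\<close> and the right-hand side is not.\<close>

lemma no_extension:
  assumes H: "H holomorphic_on ball 0 r" and r: "R_tau < r"
    and eq: "\<And>l. l \<in> branch_dom \<Longrightarrow> H (tau_map l) = profile l"
  shows False
proof -
  \<comment> \<open>The origin is removed because \<open>slope\<close> and the formula for the
    derivative of \<open>profile\<close> divide by l.\<close>
  define D where "D = branch_dom - {0}"
  have open_D: "open D"
    unfolding D_def by (intro open_Diff open_branch_dom) auto
  have D: "cos l \<noteq> 0" "l \<noteq> 0" "tau_map l \<in> ball 0 r" "cos l + l * sin l \<noteq> 0" if "l \<in> D" for l
    using that r cos_plus_mult_sin_nonzero[of l] by (auto simp: D_def branch_dom_def)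
  have chain: "((\<lambda>l. F (tau_map l)) has_field_derivative
      deriv F (tau_map l) * ((cos l + l * sin l) / (cos l)\<^sup>2)) (at l)"
    if "F holomorphic_on ball 0 r" "l \<in> D" for F l
  proof -
    have "(F has_field_derivative deriv F (tau_map l)) (at (tau_map l))"
      using that D(3)[OF that(2)] by (intro holomorphic_derivI[where S = "ball 0 r"]) auto
    from DERIV_chain2[OF this tau_map_deriv] show ?thesis
      using D(1)[OF that(2)] by blast
  qed
  have deriv_H: "deriv H (tau_map l) = slope l" if l: "l \<in> D" for l
  proof -
    have "((\<lambda>l. H (tau_map l)) has_field_derivative
        2 / l\<^sup>2 * ((cos l + l * sin l) * (l * cos l - sin l))) (at l)"
      by (rule has_field_derivative_transform_within_open
          [OF profile_deriv[OF D(2)[OF l]] open_D l])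
        (simp add: eq D_def)
    then have "deriv H (tau_map l) * ((cos l + l * sin l) / (cos l)\<^sup>2)
        = 2 / l\<^sup>2 * ((cos l + l * sin l) * (l * cos l - sin l))"
      using chain[OF H l] DERIV_unique by blast
    then have "(cos l + l * sin l) * deriv H (tau_map l) = (cos l + l * sin l) * slope l"
      using D[OF l] by (simp add: slope_def field_simps)
    then show ?thesis using D(4)[OF l] by simp
  qed
  have H': "deriv H holomorphic_on ball 0 r"
    by (intro holomorphic_deriv H) auto
  have deriv_deriv_H:
    "deriv (deriv H) (tau_map l) * ((cos l + l * sin l) / (cos l)\<^sup>2) = slope' l" if l: "l \<in> D" for l
  proof -
    have "((\<lambda>l. deriv H (tau_map l)) has_field_derivative slope' l) (at l)"
      by (rule has_field_derivative_transform_within_open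
          [OF slope_deriv[OF D(2)[OF l]] open_D l])
        (simp add: deriv_H)
    then show ?thesis
      using chain[OF H' l] DERIV_unique by blast
  qed
  define l0 where "l0 = \<i> * of_real y0"
  \<comment> \<open>The second-order identity is known only on \<open>D\<close>, and
    \<open>l0\<close> lies outside. It is carried over to \<open>l0\<close> by continuity of \<Phi>
    along the imaginary axis from below.\<close>
  define \<Phi> where "\<Phi> l = deriv (deriv H) (tau_map l) * ((cos l + l * sin l) / (cos l)\<^sup>2) - slope' l"
    for l
  have l0: "cos l0 \<noteq> 0" "l0 \<noteq> 0" "cos l0 + l0 * sin l0 = 0" "tau_map l0 \<in> ball 0 r"
    using y0_pos R_tau_pos r y0_sinh
    by (auto simp: l0_def cos_imaginary sin_imaginary tau_map_def norm_mult norm_divide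
        algebra_simps R_tau_def simp flip: of_real_mult)
  have "deriv (deriv H) holomorphic_on ball 0 r"
    by (intro holomorphic_deriv H') auto
  then have "isCont (deriv (deriv H)) (tau_map l0)"
    using l0(4) holomorphic_on_imp_continuous_on continuous_on_eq_continuous_at open_ball by blast
  with DERIV_isCont[OF tau_map_deriv[OF l0(1)]]
  have "isCont (\<lambda>l. deriv (deriv H) (tau_map l)) l0"
    by (rule isCont_o2)
  then have "isCont \<Phi> l0"
    unfolding \<Phi>_def slope'_def using l0(1,2) by (intro continuous_intros) auto
  moreover have "((\<lambda>y. \<i> * of_real y) \<longlongrightarrow> l0) (at_left y0)"
    unfolding l0_def by (intro tendsto_intros)
  ultimately have "((\<lambda>y. \<Phi> (\<i> * of_real y)) \<longlongrightarrow> \<Phi> l0) (at_left y0)"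
    using isCont_tendsto_compose by blast
  moreover have "\<forall>\<^sub>F y in at_left y0. \<Phi> (\<i> * of_real y) = 0"
    using eventually_at_left_real[OF y0_pos]
  proof eventually_elim
    case (elim y)
    then have "\<i> * of_real y \<in> D"
      by (simp add: D_def imaginary_in_branch_dom)
    then show ?case unfolding \<Phi>_def by (simp only: deriv_deriv_H diff_self)
  qed
  then have "((\<lambda>y. \<Phi> (\<i> * of_real y)) \<longlongrightarrow> 0) (at_left y0)"
    by (rule tendsto_eventually)
  ultimately have "\<Phi> l0 = 0"
    by (rule tendsto_unique[OF trivial_limit_at_left_real])
  then show False
    using slope'_y0 l0(3) by (simp add: \<Phi>_def l0_def)
qed

subsection \<open>The radius of convergence\<close>

lemma ex_analytic_local_inverse: "\<exists>lam. analytic_local_inverse_at_0 tau_map lam"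
proof -
  obtain G where G: "G holomorphic_on ball 0 R_tau" "\<And>l. l \<in> branch_dom \<Longrightarrow> G (tau_map l) = l"
    "\<And>t. norm t < R_tau \<Longrightarrow> G t \<in> branch_dom \<and> tau_map (G t) = t"
    using ex_branch by blast
  have "G analytic_on {0}"
    using G(1) R_tau_pos by (auto simp: analytic_at intro!: exI[of _ "ball 0 R_tau"])
  moreover have "G 0 = 0"
    using G(2)[OF zero_in_branch_dom] by (simp add: tau_map_def)
  moreover have "\<forall>\<^sub>F t in nhds 0. tau_map (G t) = t"
    using eventually_nhds_in_open[of "ball 0 R_tau" 0] R_tau_pos
    by (auto elim!: eventually_mono simp: G(3))
  moreover have "\<forall>\<^sub>F l in nhds 0. G (tau_map l) = l"
    using eventually_nhds_in_open[OF open_branch_dom zero_in_branch_dom]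
    by (auto elim!: eventually_mono simp: G(2))
  ultimately show ?thesis
    unfolding analytic_local_inverse_at_0_def by blast
qed

text \<open>Continuity brings \<open>lam t\<close> into \<open>branch_dom\<close> for small t; there
  \<open>G\<close> undoes \<open>tau_map\<close>.\<close>

lemma analytic_local_inverse_unique:
  assumes lam: "analytic_local_inverse_at_0 tau_map lam"
    and G: "\<And>l. l \<in> branch_dom \<Longrightarrow> G (tau_map l) = l"
  shows "\<forall>\<^sub>F t in nhds 0. lam t = G t"
proof -
  have "isCont lam 0"
    using lam analytic_at_imp_isCont unfolding analytic_local_inverse_at_0_def by blast
  then have "filterlim lam (nhds 0) (nhds 0)"
    using lam by (simp add: analytic_local_inverse_at_0_def isCont_def tendsto_at_iff_tendsto_nhds)
  then have "\<forall>\<^sub>F t in nhds 0. lam t \<in> branch_dom"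
    using eventually_nhds_in_open[OF open_branch_dom zero_in_branch_dom]
    by (auto simp: filterlim_iff)
  moreover have "\<forall>\<^sub>F t in nhds 0. tau_map (lam t) = t"
    using lam by (simp add: analytic_local_inverse_at_0_def)
  ultimately show ?thesis
    by eventually_elim (use G in metis)
qed

lemma Sigma_BS_sq_fps:
  fixes c :: real
  assumes c: "0 < c" and lam: "analytic_local_inverse_at_0 tau_map lam"
  defines "f \<equiv> \<lambda>T. Sigma_BS_sq lam (of_real c * T)"
  shows "f has_fps_expansion fps_expansion f 0"
    and "fps_conv_radius (fps_expansion f 0) = ereal (R_tau / c)"
proof -
  obtain G where G: "G holomorphic_on ball 0 R_tau" "\<And>l. l \<in> branch_dom \<Longrightarrow> G (tau_map l) = l"
    "\<And>t. norm t < R_tau \<Longrightarrow> G t \<in> branch_dom \<and> tau_map (G t) = t"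
    using ex_branch by blast
  define g where "g T = profile (G (of_real c * T))" for T
  have c_ball: "of_real c * T \<in> ball 0 R_tau \<longleftrightarrow> T \<in> ball 0 (R_tau / c)" for T :: complex
    using c by (simp add: norm_mult field_simps)
  have "(profile \<circ> (G \<circ> (*) (of_real c))) holomorphic_on ball 0 (R_tau / c)"
    by (intro holomorphic_on_compose_gen[OF _ profile_holomorphic, of _ _ UNIV]
        holomorphic_on_compose_gen[OF _ G(1)] holomorphic_intros) (use c_ball in auto)
  then have g_hol: "g holomorphic_on ball 0 (R_tau / c)"
    by (simp add: g_def[abs_def] o_def)
  have "filterlim (\<lambda>T. of_real c * T) (nhds (0::complex)) (nhds 0)"
    by (rule tendsto_eq_intros) (auto intro!: tendsto_eq_intros filterlim_ident)
  with analytic_local_inverse_unique[OF lam G(2)]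
  have "\<forall>\<^sub>F T in nhds 0. lam (of_real c * T) = G (of_real c * T)"
    by (rule eventually_compose_filterlim)
  then have fg: "\<forall>\<^sub>F T in nhds 0. f T = g T"
    by eventually_elim (simp add: f_def g_def Sigma_BS_sq_eq_profile)
  then have fps_eq: "fps_expansion f 0 = fps_expansion g 0"
    by (rule fps_expansion_cong)
  have radius: "0 < R_tau / c" using c R_tau_pos by simp
  have "g has_fps_expansion fps_expansion g 0"
    using g_hol radius by (intro analytic_at_imp_has_fps_expansion_0)
      (auto simp: analytic_at intro!: exI[of _ "ball 0 (R_tau / c)"])
  then show f_exp: "f has_fps_expansion fps_expansion f 0"
    unfolding fps_eq has_fps_expansion_def using fg by (auto elim: eventually_elim2)
  \<comment> \<open>A Taylor series converges on every disc about its centre where the function is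
    holomorphic.\<close>
  have "ereal (R_tau / c) \<le> fps_conv_radius (fps_expansion f 0)"
    unfolding fps_eq using g_hol by (intro conv_radius_fps_expansion) simp
  moreover have "\<not> ereal (R_tau / c) < fps_conv_radius (fps_expansion f 0)"
  proof
    define P where "P = fps_expansion f 0"
    assume "ereal (R_tau / c) < fps_conv_radius (fps_expansion f 0)"
    then obtain r where r: "R_tau / c < r" "ereal r < fps_conv_radius P"
      unfolding P_def using ereal_dense2 by (metis less_ereal.simps(1))
    \<comment> \<open>Undoing the time scaling turns a larger radius of convergence into an
      extension past \<open>R_tau\<close>.\<close>
    define H where "H t = eval_fps P (t / of_real c)" for t
    have P_hol: "eval_fps P holomorphic_on ball 0 r"
    proof (intro holomorphic_intros subsetI)
      fix x :: complex assume "x \<in> ball 0 r"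
      then have "ereal (norm x) < ereal r" by simp
      then show "x \<in> eball 0 (fps_conv_radius P)"
        using less_trans[OF _ r(2)] by (simp add: in_eball_iff)
    qed
    have "(eval_fps P \<circ> (\<lambda>t. t / of_real c)) holomorphic_on ball 0 (c * r)"
      by (intro holomorphic_on_compose_gen[OF _ P_hol] holomorphic_intros)
        (use c in \<open>auto simp: norm_divide field_simps\<close>)
    then have "H holomorphic_on ball 0 (c * r)"
      by (simp add: H_def[abs_def] o_def)
    moreover have "R_tau < c * r"
      using r(1) c by (simp add: field_simps)
    moreover have "H (tau_map l) = profile l" if l: "l \<in> branch_dom" for l
    proof -
      have "\<forall>\<^sub>F T in nhds 0. eval_fps P T = g T"
        using f_exp fg unfolding has_fps_expansion_def P_def by (auto elim: eventually_elim2)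
      then obtain U where U: "open U" "0 \<in> U" "\<And>T. T \<in> U \<Longrightarrow> eval_fps P T = g T"
        unfolding eventually_nhds by blast
      \<comment> \<open>The series is known to equal \<open>g\<close> only near 0; the identity
        theorem spreads this to the whole disc.\<close>
      have "eval_fps P (tau_map l / of_real c) = g (tau_map l / of_real c)"
      proof (rule analytic_continuation_open[where s = "U \<inter> ball 0 (R_tau / c)"
            and s' = "ball 0 (R_tau / c)" and z = "tau_map l / of_real c"])
        show "eval_fps P holomorphic_on ball 0 (R_tau / c)"
          using r(1) by (intro holomorphic_on_subset[OF P_hol]) auto
        show "tau_map l / of_real c \<in> ball 0 (R_tau / c)"
          using l c by (simp add: branch_dom_def norm_divide divide_strict_right_mono)
      qed (use U radius g_hol in auto)
      then show ?thesis
        using G(2)[OF l] c by (simp add: H_def g_def)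
    qed
    ultimately show False using no_extension by blast
  qed
  ultimately show "fps_conv_radius (fps_expansion f 0) = ereal (R_tau / c)"
    by simp
qed

theorem mainTheorem6:
  fixes \<omega> \<sigma>0 T_c :: real
  assumes "0 < \<omega>" and "0 < \<sigma>0"
    and "T_c = 2 * R_tau / (\<omega> * \<sigma>0)"
  shows "(\<exists>!y::real. 0 < y \<and> y * tanh y = 1) \<and>
    \<bar>y0 - 1.19968\<bar> < 0.000005 \<and>
    \<bar>R_tau - 0.662743\<bar> < 0.0000005 \<and>
    1.32 / (\<omega> * \<sigma>0) \<le> T_c \<and> T_c < 1.33 / (\<omega> * \<sigma>0) \<and>
    (\<exists>lam. analytic_local_inverse_at_0 tau_map lam) \<and>
    (\<forall>lam. analytic_local_inverse_at_0 tau_map lam \<longrightarrow>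
      (let f = (\<lambda>T. Sigma_BS_sq lam (1 / 2 * of_real \<omega> * of_real \<sigma>0 * T)) in
        f has_fps_expansion fps_expansion f 0 \<and>
        fps_conv_radius (fps_expansion f 0) = ereal T_c))"
proof (intro conjI allI impI)
  have pos: "0 < \<omega> * \<sigma>0" using assms by simp
  show "\<bar>y0 - 1.19968\<bar> < 0.000005"
    using y0_bounds by (simp add: abs_less_iff)
  show "\<bar>R_tau - 0.662743\<bar> < 0.0000005"
    using R_tau_bounds unfolding abs_less_iff by simp
  \<comment> \<open>\<open>2 * R_tau\<close> is 1.32548..., so 1.32 is a truncation, not a rounding;
    hence the interval from 1.32 to 1.33.\<close>
  have "1.32 \<le> 2 * R_tau" "2 * R_tau < 1.33"
    using R_tau_bounds by simp_all
  then show "1.32 / (\<omega> * \<sigma>0) \<le> T_c" "T_c < 1.33 / (\<omega> * \<sigma>0)"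
    unfolding assms(3) using pos
    by (blast intro: divide_right_mono less_imp_le divide_strict_right_mono)+
  fix lam assume lam: "analytic_local_inverse_at_0 tau_map lam"
  have half: "1 / 2 * of_real \<omega> * of_real \<sigma>0 = complex_of_real (\<omega> * \<sigma>0 / 2)"
    by simp
  have T_c: "T_c = R_tau / (\<omega> * \<sigma>0 / 2)"
    by (simp add: assms(3))
  show "let f = (\<lambda>T. Sigma_BS_sq lam (1 / 2 * of_real \<omega> * of_real \<sigma>0 * T)) in
        f has_fps_expansion fps_expansion f 0 \<and>
        fps_conv_radius (fps_expansion f 0) = ereal T_c"
    unfolding Let_def half T_c
    using Sigma_BS_sq_fps[OF _ lam, of "\<omega> * \<sigma>0 / 2"] pos by simp
qed (fact ex1_crit ex_analytic_local_inverse)+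

end
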